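(* Let $p$ be a prime. Every nongyrocommutative gyrogroup of order $p^3$ has the strong Cauchy property.
   Context: A gyrogroup is a set $G$ with a binary operation $\oplus$ such that: (G1) there is $0\in G$ with $0\oplus a=a$ for all $a\in G$; (G2) for each $a\in G$ there is $b\in G$ with $b\oplus a=0$; (G3) for all $a,b\in G$ there is an automorphism $\mathrm{gyr}[a,b]$ of $(G,\oplus)$ with $a\oplus(b\oplus c)=(a\oplus b)\oplus \mathrm{gyr}[a,b]c$ for all $c\in G$; (G4) $\mathrm{gyr}[a,b]=\mathrm{gyr}[a\oplus b,b]$ for all $a,b\in G$. (It is known that $0$ is then a two-sided identity and every $a$ has a unique two-sided inverse, written $\ominus a$.) A gyrogroup $G$ is gyrocommutative if $a\oplus b=\mathrm{gyr}[a,b](b\oplus a)$ for all $a,b\in G$, and nongyrocommutative otherwise. A nonempty subset $H$ of a gyrogroup $G$ is a subgyrogroup (written $H\leqslant G$) if it is a gyrogroup under the operation inherited from $G$ and, for all $a,b\in H$, the restriction of $\mathrm{gyr}[a,b]$ to $H$ is an automorphism of $H$; equivalently, $H$ is closed under $\oplus$ and $\ominus$. For $a\in G$, $\langle a\rangle$ denotes the smallest subgyrogroup of $G$ containing $a$, and the order $|a|$ of $a$ is the cardinality of $\langle a\rangle$. A finite gyrogroup $G$ has the weak Cauchy property if for every prime $p$ dividing $|G|$, $G$ has an element of order $p$. A finite gyrogroup has the strong Cauchy property if every one of its subgyrogroups has the weak Cauchy property. *)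

theory Defs
  imports Main "HOL-Computational_Algebra.Primes"
begin

definition magma_automorphism :: "'a set \<Rightarrow> ('a \<Rightarrow> 'a \<Rightarrow> 'a) \<Rightarrow> ('a \<Rightarrow> 'a) \<Rightarrow> bool" where
  "magma_automorphism G oplus f \<longleftrightarrow>
     bij_betw f G G \<and> (\<forall>x\<in>G. \<forall>y\<in>G. f (oplus x y) = oplus (f x) (f y))"

text \<open>
  The gyrator is a parameter of the locale, constrained only on the carrier. It is determined
  on the carrier by the operation (lemma \<open>gyr_unique\<close>), so a theorem that
  quantifies over all gyrators is a theorem about the pair of carrier and operation.
\<close>

locale gyrogroup =
  fixes G :: "'a set"
    and oplus :: "'a \<Rightarrow> 'a \<Rightarrow> 'a"  (infixl "\<oplus>" 65)
    and gyr :: "'a \<Rightarrow> 'a \<Rightarrow> 'a \<Rightarrow> 'a"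
  assumes closed: "\<lbrakk>a \<in> G; b \<in> G\<rbrakk> \<Longrightarrow> a \<oplus> b \<in> G"
    and left_zero_inverse:
      "\<exists>z\<in>G. (\<forall>a\<in>G. z \<oplus> a = a) \<and> (\<forall>a\<in>G. \<exists>b\<in>G. b \<oplus> a = z)"
    and gyr_automorphism: "\<lbrakk>a \<in> G; b \<in> G\<rbrakk> \<Longrightarrow> magma_automorphism G (\<oplus>) (gyr a b)"
    and left_gyroassociative:
      "\<lbrakk>a \<in> G; b \<in> G; c \<in> G\<rbrakk> \<Longrightarrow> a \<oplus> (b \<oplus> c) = (a \<oplus> b) \<oplus> gyr a b c"
    and left_loop: "\<lbrakk>a \<in> G; b \<in> G; c \<in> G\<rbrakk> \<Longrightarrow> gyr a b c = gyr (a \<oplus> b) b c"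

definition gyrocommutative ::
  "'a set \<Rightarrow> ('a \<Rightarrow> 'a \<Rightarrow> 'a) \<Rightarrow> ('a \<Rightarrow> 'a \<Rightarrow> 'a \<Rightarrow> 'a) \<Rightarrow> bool" where
  "gyrocommutative G oplus gyr \<longleftrightarrow> (\<forall>a\<in>G. \<forall>b\<in>G. oplus a b = gyr a b (oplus b a))"

definition subgyrogroup ::
  "'a set \<Rightarrow> 'a set \<Rightarrow> ('a \<Rightarrow> 'a \<Rightarrow> 'a) \<Rightarrow> ('a \<Rightarrow> 'a \<Rightarrow> 'a \<Rightarrow> 'a) \<Rightarrow> bool" where
  "subgyrogroup H G oplus gyr \<longleftrightarrow>
     H \<noteq> {} \<and> H \<subseteq> G \<and> (\<exists>gyrH. gyrogroup H oplus gyrH) \<and>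
     (\<forall>a\<in>H. \<forall>b\<in>H. magma_automorphism H oplus (gyr a b))"

text \<open>
  The smallest subgyrogroup containing an element; see \<open>generated_subgyrogroup\<close> and
  \<open>generated_least\<close>.
\<close>

definition generated ::
  "'a set \<Rightarrow> ('a \<Rightarrow> 'a \<Rightarrow> 'a) \<Rightarrow> ('a \<Rightarrow> 'a \<Rightarrow> 'a \<Rightarrow> 'a) \<Rightarrow> 'a \<Rightarrow> 'a set" where
  "generated G oplus gyr a = \<Inter>{H. subgyrogroup H G oplus gyr \<and> a \<in> H}"

text \<open>As for \<^const>\<open>card\<close>, elements of infinite order get order 0.\<close>

definition gyro_order ::
  "'a set \<Rightarrow> ('a \<Rightarrow> 'a \<Rightarrow> 'a) \<Rightarrow> ('a \<Rightarrow> 'a \<Rightarrow> 'a \<Rightarrow> 'a) \<Rightarrow> 'a \<Rightarrow> nat" where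
  "gyro_order G oplus gyr a = card (generated G oplus gyr a)"

definition weak_Cauchy_property ::
  "'a set \<Rightarrow> ('a \<Rightarrow> 'a \<Rightarrow> 'a) \<Rightarrow> ('a \<Rightarrow> 'a \<Rightarrow> 'a \<Rightarrow> 'a) \<Rightarrow> bool" where
  "weak_Cauchy_property G oplus gyr \<longleftrightarrow>
     finite G \<and>
     (\<forall>p::nat. prime p \<longrightarrow> p dvd card G \<longrightarrow> (\<exists>a\<in>G. gyro_order G oplus gyr a = p))"

definition strong_Cauchy_property ::
  "'a set \<Rightarrow> ('a \<Rightarrow> 'a \<Rightarrow> 'a) \<Rightarrow> ('a \<Rightarrow> 'a \<Rightarrow> 'a \<Rightarrow> 'a) \<Rightarrow> bool" where
  "strong_Cauchy_property G oplus gyr \<longleftrightarrow>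
     finite G \<and>
     (\<forall>H. subgyrogroup H G oplus gyr \<longrightarrow> weak_Cauchy_property H oplus gyr)"

context gyrogroup
begin

lemma gyr_closed: "\<lbrakk>a \<in> G; b \<in> G; c \<in> G\<rbrakk> \<Longrightarrow> gyr a b c \<in> G"
  using gyr_automorphism[of a b] by (auto simp: magma_automorphism_def bij_betw_def)

lemma gyr_inj: "\<lbrakk>a \<in> G; b \<in> G; x \<in> G; y \<in> G; gyr a b x = gyr a b y\<rbrakk> \<Longrightarrow> x = y"
  using gyr_automorphism[of a b] by (auto simp: magma_automorphism_def bij_betw_def inj_on_def)

lemma left_cancel:
  assumes "a \<in> G" "x \<in> G" "y \<in> G" "a \<oplus> x = a \<oplus> y"
  shows "x = y"
proof -
  obtain z where z: "z \<in> G" "\<forall>a\<in>G. z \<oplus> a = a" "\<forall>a\<in>G. \<exists>b\<in>G. b \<oplus> a = z"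
    using left_zero_inverse by blast
  obtain b where b: "b \<in> G" "b \<oplus> a = z" using z assms by blast
  have "gyr b a c = b \<oplus> (a \<oplus> c)" if "c \<in> G" for c
    using left_gyroassociative[of b a c] gyr_closed[of b a c] that b assms z by auto
  then show ?thesis using gyr_inj[of b a x y] assms b by simp
qed

lemma gyr_unique:
  assumes "gyrogroup G (\<oplus>) gyr'" "a \<in> G" "b \<in> G" "c \<in> G"
  shows "gyr' a b c = gyr a b c"
  using left_cancel[of "a \<oplus> b" "gyr' a b c" "gyr a b c"] assms closed
    gyr_closed gyrogroup.gyr_closed[OF assms(1)]
    left_gyroassociative gyrogroup.left_gyroassociative[OF assms(1)]
  by metis

lemma left_inverse_cancel:
  assumes z: "z \<in> G" "\<forall>a\<in>G. z \<oplus> a = a" and b: "b \<in> G" "a \<in> G" "b \<oplus> a = z" and "c \<in> G"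
  shows "b \<oplus> (a \<oplus> c) = c"
proof -
  have "a \<oplus> gyr z a c = a \<oplus> c"
    using left_gyroassociative[of z a c] assms closed by auto
  then have "gyr z a c = c"
    using left_cancel[of a "gyr z a c" c] assms gyr_closed by auto
  then have "gyr b a c = c" using left_loop[of b a c] assms by simp
  then show ?thesis using left_gyroassociative[of b a c] assms by simp
qed

lemma right_zero:
  assumes z: "z \<in> G" "\<forall>a\<in>G. z \<oplus> a = a" "\<forall>a\<in>G. \<exists>b\<in>G. b \<oplus> a = z" and "a \<in> G"
  shows "a \<oplus> z = a"
proof -
  obtain b where b: "b \<in> G" "b \<oplus> a = z" using z assms by blast
  have "b \<oplus> (a \<oplus> z) = z" using left_inverse_cancel[of z b a z] b assms by simp
  then show ?thesis using left_cancel[of b "a \<oplus> z" a] b assms closed by simp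
qed

lemma idempotent_unique:
  assumes "e \<in> G" "e \<oplus> e = e" "e' \<in> G" "e' \<oplus> e' = e'"
  shows "e = e'"
proof -
  obtain z where z: "z \<in> G" "\<forall>a\<in>G. z \<oplus> a = a" "\<forall>a\<in>G. \<exists>b\<in>G. b \<oplus> a = z"
    using left_zero_inverse by blast
  show ?thesis
    using right_zero[OF z] left_cancel z(1) assms by metis
qed

lemma left_inverse_unique:
  assumes z: "z \<in> G" "\<forall>a\<in>G. z \<oplus> a = a" "\<forall>a\<in>G. \<exists>b\<in>G. b \<oplus> a = z"
    and "a \<in> G" "b \<in> G" "b' \<in> G" "b \<oplus> a = z" "b' \<oplus> a = z"
  shows "b = b'"
proof -
  have "a \<oplus> c = z" if "c \<in> G" "c \<oplus> a = z" for c
    using left_inverse_cancel[OF z(1,2), of c a c] right_zero[OF z, of c]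
      left_cancel[of c "a \<oplus> c" z] that assms closed by auto
  then show ?thesis using left_cancel[of a b b'] assms by simp
qed

lemma subgyrogroup_self: "subgyrogroup G G (\<oplus>) gyr"
  unfolding subgyrogroup_def
  using left_zero_inverse gyr_automorphism gyrogroup_axioms by blast

lemma subgyrogroup_gyrogroup:
  assumes "subgyrogroup H G (\<oplus>) gyr"
  shows "gyrogroup H (\<oplus>) gyr"
proof -
  obtain g where g: "gyrogroup H (\<oplus>) g" and "H \<subseteq> G"
    and "\<forall>a\<in>H. \<forall>b\<in>H. magma_automorphism H (\<oplus>) (gyr a b)"
    using assms unfolding subgyrogroup_def by blast
  then show ?thesis
    using gyrogroup.closed[OF g] gyrogroup.left_zero_inverse[OF g]
      left_gyroassociative left_loop
    by (unfold_locales) (auto simp: subset_iff)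
qed

lemma subgyrogroup_Inter:
  assumes sub: "\<And>H. H \<in> A \<Longrightarrow> subgyrogroup H G (\<oplus>) gyr" and "A \<noteq> {}"
  shows "subgyrogroup (\<Inter>A) G (\<oplus>) gyr"
proof -
  note gH = subgyrogroup_gyrogroup[OF sub]
  have subset: "H \<subseteq> G" if "H \<in> A" for H using sub[OF that] by (simp add: subgyrogroup_def)
  then have InterG: "\<Inter>A \<subseteq> G" using \<open>A \<noteq> {}\<close> by blast
  obtain z where z: "z \<in> G" "\<forall>a\<in>G. z \<oplus> a = a" "\<forall>a\<in>G. \<exists>b\<in>G. b \<oplus> a = z"
    using left_zero_inverse by blast
  have zH: "z \<in> H \<and> (\<forall>a\<in>H. \<exists>b\<in>H. b \<oplus> a = z)" if H: "H \<in> A" for H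
  proof -
    obtain e where e: "e \<in> H" "\<forall>a\<in>H. e \<oplus> a = a" "\<forall>a\<in>H. \<exists>b\<in>H. b \<oplus> a = e"
      using gyrogroup.left_zero_inverse[OF gH[OF H]] by blast
    have "e = z" using idempotent_unique[of e z] e z subset[OF H] by auto
    with e show ?thesis by blast
  qed
  have inv: "\<exists>b\<in>\<Inter>A. b \<oplus> a = z" if a: "a \<in> \<Inter>A" for a
  proof -
    obtain b where b: "b \<in> G" "b \<oplus> a = z" using z(3) a InterG by blast
    have "b \<in> H" if H: "H \<in> A" for H
    proof -
      obtain c where "c \<in> H" "c \<oplus> a = z" using zH[OF H] a H by blast
      then show ?thesis
        using left_inverse_unique[OF z, of a b c] b a InterG subset[OF H] by blast
    qed
    with b show ?thesis by blast
  qed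
  have aut: "magma_automorphism (\<Inter>A) (\<oplus>) (gyr a b)" if ab: "a \<in> \<Inter>A" "b \<in> \<Inter>A" for a b
  proof -
    have abG: "a \<in> G" "b \<in> G" using ab InterG by auto
    have H: "gyr a b ` H = H" if "H \<in> A" for H
      using gyrogroup.gyr_automorphism[OF gH[OF that], of a b] ab that
      by (auto simp: magma_automorphism_def bij_betw_def)
    have inj: "inj_on (gyr a b) G"
      using gyr_automorphism[OF abG] by (simp add: magma_automorphism_def bij_betw_def)
    have "gyr a b ` \<Inter>A = \<Inter>A"
      using image_INT[OF inj, of A "\<lambda>H. H"] subset \<open>A \<noteq> {}\<close> H by auto
    then show ?thesis
      using gyr_automorphism[OF abG] InterG inj_on_subset[OF inj InterG]
      by (auto simp: magma_automorphism_def bij_betw_def subset_iff)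
  qed
  have "gyrogroup (\<Inter>A) (\<oplus>) gyr"
  proof
    show "\<exists>z\<in>\<Inter>A. (\<forall>a\<in>\<Inter>A. z \<oplus> a = a) \<and> (\<forall>a\<in>\<Inter>A. \<exists>b\<in>\<Inter>A. b \<oplus> a = z)"
      using zH inv z(2) InterG by (intro bexI[of _ z]) auto
    show "a \<oplus> b \<in> \<Inter>A" if "a \<in> \<Inter>A" "b \<in> \<Inter>A" for a b
      using that gyrogroup.closed[OF gH] by blast
  qed (use aut in simp, (intro left_gyroassociative left_loop subsetD[OF InterG]; assumption)+)
  then show ?thesis
    unfolding subgyrogroup_def using aut zH InterG by blast
qed

lemma generated_subgyrogroup:
  assumes "a \<in> G"
  shows "subgyrogroup (generated G (\<oplus>) gyr a) G (\<oplus>) gyr" "a \<in> generated G (\<oplus>) gyr a"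
  unfolding generated_def
  using subgyrogroup_Inter[of "{H. subgyrogroup H G (\<oplus>) gyr \<and> a \<in> H}"] subgyrogroup_self assms
  by blast+

lemma generated_least:
  "\<lbrakk>subgyrogroup H G (\<oplus>) gyr; a \<in> H\<rbrakk> \<Longrightarrow> generated G (\<oplus>) gyr a \<subseteq> H"
  unfolding generated_def by blast

end

end

theory Submission
  imports Defs
begin

text \<open>
  An element \<open>a\<close> of a finite gyrogroup acts on it by left translation with all orbits of
  length \<open>|a|\<close> (lemma \<open>ltr_multiple\<close>: the left translation by the \<open>n\<close>-th multiple of \<open>a\<close> is
  the \<open>n\<close>-th power of the left translation by \<open>a\<close>). So element orders divide the order of
  every subgyrogroup that contains them, and a gyrogroup of \<open>p\<close>-power order has the weak
  Cauchy property (\<open>prime_power_weak_Cauchy\<close>). What remains is a Lagrange statement: every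
  subgyrogroup \<open>H\<close> of a nongyrocommutative gyrogroup \<open>G\<close> of order \<open>p\<^sup>3\<close> has \<open>p\<close>-power order.

  For \<open>p = 2\<close> it is enough that a nontrivial \<open>H\<close> has even order and that a proper \<open>H\<close> fills at
  most half of \<open>G\<close> (\<open>Lagrange_order_eight\<close>).

  For odd \<open>p\<close>, nongyrocommutativity supplies a nontrivial left nucleus \<open>N\<close>, the set of those
  \<open>n\<close> with \<open>n \<oplus> (x \<oplus> y) = (n \<oplus> x) \<oplus> y\<close>
  (\<open>trivial_left_nucleus_imp_gyrocommutative\<close>). The left nucleus is a normal subgroup,
  so the cosets of \<open>N\<close> form a gyrogroup whose order divides \<open>p\<^sup>2\<close>. There Lagrange is easy:
  two different subgyrogroups of order \<open>p\<close> meet trivially, so the sums of their elements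
  already make up \<open>p\<^sup>2\<close> elements (\<open>Lagrange_prime_square\<close>). Finally \<open>|H|\<close> is the product of
  \<open>|N \<inter> H|\<close> and the order of the image of \<open>H\<close> (\<open>card_coset_image\<close>), both powers of \<open>p\<close>.

  The heart is the link between the left nucleus and gyrocommutativity. Let \<open>A\<close> be the set of
  left translations. The left loop property says exactly that \<open>A\<close> is closed under
  \<open>(f, g) \<mapsto> f g f\<close>, so \<open>A\<close> contains every palindromic product of its members. If a word
  in \<open>A\<close> has value 1, its reversal \<open>k\<close> satisfies \<open>k A \<subseteq> A\<close>, since \<open>k x\<close> equals the
  palindrome formed by \<open>k\<close>, \<open>x\<close> and the word; hence \<open>k\<close> is the translation by an element
  of the left nucleus. If the latter is trivial, then identities between words in \<open>A\<close> may be
  reversed. Reversing the statement that gyrations permute \<open>A\<close> by conjugation shows that for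
  \<open>c = a \<oplus> b\<close> the palindrome \<open>b a c\<^sup>-\<^sup>2 a b\<close> commutes with \<open>A\<close>. When the order is odd, a
  central member of \<open>A\<close> is the square of a central member, so it lies in the left nucleus as
  well and is 1. Then \<open>c\<^sup>2 = a b\<^sup>2 a\<close>, which amounts to gyrocommutativity.
\<close>

section \<open>Neutral element, inverses and left translations\<close>

context gyrogroup
begin

definition neutral :: 'a where
  "neutral = (SOME z. z \<in> G \<and> (\<forall>a\<in>G. z \<oplus> a = a) \<and> (\<forall>a\<in>G. \<exists>b\<in>G. b \<oplus> a = z))"

definition neg :: "'a \<Rightarrow> 'a" where
  "neg a = (SOME b. b \<in> G \<and> b \<oplus> a = neutral)"

lemma neutral_spec:
  "neutral \<in> G \<and> (\<forall>a\<in>G. neutral \<oplus> a = a) \<and> (\<forall>a\<in>G. \<exists>b\<in>G. b \<oplus> a = neutral)"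
  unfolding neutral_def by (rule someI_ex) (use left_zero_inverse in blast)

lemma neutral_closed [simp]: "neutral \<in> G"
  and neutral_left [simp]: "a \<in> G \<Longrightarrow> neutral \<oplus> a = a"
  using neutral_spec by auto

lemma neutral_right [simp]: "a \<in> G \<Longrightarrow> a \<oplus> neutral = a"
  using right_zero[of neutral a] neutral_spec by auto

lemma neg_spec: "a \<in> G \<Longrightarrow> neg a \<in> G \<and> neg a \<oplus> a = neutral"
  unfolding neg_def by (rule someI_ex) (use neutral_spec in blast)

lemma neg_closed [simp]: "a \<in> G \<Longrightarrow> neg a \<in> G"
  and neg_left [simp]: "a \<in> G \<Longrightarrow> neg a \<oplus> a = neutral"
  using neg_spec by auto

lemmas closed [simp]

lemma neg_cancel [simp]: "\<lbrakk>a \<in> G; c \<in> G\<rbrakk> \<Longrightarrow> neg a \<oplus> (a \<oplus> c) = c"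
  using left_inverse_cancel[of neutral "neg a" a c] by simp

lemma neg_right [simp]: "a \<in> G \<Longrightarrow> a \<oplus> neg a = neutral"
  using neg_cancel[of a "neg a"] left_cancel[of "neg a" "a \<oplus> neg a" neutral] by simp

lemma neg_cancel' [simp]: "\<lbrakk>a \<in> G; c \<in> G\<rbrakk> \<Longrightarrow> a \<oplus> (neg a \<oplus> c) = c"
  using left_inverse_cancel[of neutral a "neg a" c] by simp

text \<open>
  This is the left loop property in disguise: with \<open>d = neg b\<close> and \<open>e = b \<oplus> a\<close>, so that
  \<open>d \<oplus> e = a\<close>, it equates the gyrations of \<open>(d, e)\<close> and \<open>(a, e)\<close>. Writing \<open>x\<close> as the common
  value at some \<open>y\<close> and applying gyroassociativity to both pairs gives the identity.
\<close>
lemma Bol_identity: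
  assumes "a \<in> G" "b \<in> G" "x \<in> G"
  shows "a \<oplus> (b \<oplus> (a \<oplus> x)) = (a \<oplus> (b \<oplus> a)) \<oplus> x"
proof -
  define d e where "d = neg b" and "e = b \<oplus> a"
  have G: "d \<in> G" "e \<in> G" using assms by (auto simp: d_def e_def)
  have b: "b \<oplus> (d \<oplus> y) = y" if "y \<in> G" for y using assms that by (simp add: d_def)
  have de: "d \<oplus> e = a" using assms by (simp add: d_def e_def)
  obtain y where y: "y \<in> G" "gyr d e y = x"
    using gyr_automorphism[OF G] assms(3)
    unfolding magma_automorphism_def bij_betw_def by (metis imageE)
  have "a \<oplus> x = d \<oplus> (e \<oplus> y)" using left_gyroassociative[OF G y(1)] de y by simp
  then have "a \<oplus> (b \<oplus> (a \<oplus> x)) = a \<oplus> (e \<oplus> y)" using b G y by simp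
  also have "\<dots> = (a \<oplus> e) \<oplus> gyr a e y" using left_gyroassociative assms G y by simp
  also have "gyr a e y = x" using left_loop[OF G y(1)] de y by simp
  finally show ?thesis by (simp add: e_def)
qed

text \<open>
  Outside the carrier a translation is the identity, so that translations are permutations of
  the whole type and products of them are plain compositions.
\<close>
definition ltr :: "'a \<Rightarrow> 'a \<Rightarrow> 'a" where
  "ltr a = (\<lambda>x. if x \<in> G then a \<oplus> x else x)"

lemma ltr_neutral: "ltr neutral = id"
  by (auto simp: ltr_def)

lemma ltr_apply_neutral [simp]: "a \<in> G \<Longrightarrow> ltr a neutral = a"
  by (simp add: ltr_def)

lemma ltr_inject: "\<lbrakk>a \<in> G; b \<in> G; ltr a = ltr b\<rbrakk> \<Longrightarrow> a = b"
  by (metis ltr_apply_neutral)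

lemma ltr_neg_cancel [simp]:
  assumes "a \<in> G"
  shows "ltr (neg a) \<circ> ltr a = id" "ltr a \<circ> ltr (neg a) = id"
    "ltr (neg a) \<circ> (ltr a \<circ> f) = f" "ltr a \<circ> (ltr (neg a) \<circ> f) = f"
  using assms by (auto simp: ltr_def fun_eq_iff)

lemma ltr_Bol:
  assumes "a \<in> G" "b \<in> G"
  shows "ltr a \<circ> (ltr b \<circ> ltr a) = ltr (a \<oplus> (b \<oplus> a))"
  using assms Bol_identity by (auto simp: ltr_def fun_eq_iff)

lemma ltr_sandwich:
  assumes "a \<in> G" "f \<in> ltr ` G"
  shows "ltr a \<circ> (f \<circ> ltr a) \<in> ltr ` G"
  using assms ltr_Bol by auto

text \<open>
  Gyrations are products of translations and their inverses, so closure under sums and inverses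
  makes every gyration, as well as its inverse, map the subset into itself.
\<close>
lemma subgyrogroup_iff:
  "subgyrogroup H G (\<oplus>) gyr \<longleftrightarrow>
     H \<subseteq> G \<and> neutral \<in> H \<and> (\<forall>a\<in>H. \<forall>b\<in>H. a \<oplus> b \<in> H) \<and> (\<forall>a\<in>H. neg a \<in> H)"
    (is "?S \<longleftrightarrow> ?C")
proof
  assume S: ?S
  interpret H: gyrogroup H "(\<oplus>)" gyr by (rule subgyrogroup_gyrogroup[OF S])
  have HG: "H \<subseteq> G" using S by (simp add: subgyrogroup_def)
  have z: "H.neutral = neutral"
    by (rule idempotent_unique) (use HG H.neutral_closed in blast, simp_all)
  have "neg a \<in> H" if "a \<in> H" for a
  proof -
    have "a \<in> G" "H.neg a \<in> G" "H.neg a \<oplus> a = neutral"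
      using that HG H.neg_closed[of a] H.neg_left[of a] z by (blast, blast, metis)
    then have "H.neg a = neg a"
      using left_inverse_unique[of neutral a "H.neg a" "neg a"] neutral_spec by simp
    then show ?thesis using H.neg_closed[OF that] by simp
  qed
  then show ?C using HG z H.neutral_closed H.closed by auto
next
  assume C: ?C
  have gyr_eq: "gyr a b c = neg (a \<oplus> b) \<oplus> (a \<oplus> (b \<oplus> c))" if "a \<in> G" "b \<in> G" "c \<in> G" for a b c
    using left_gyroassociative[of a b c] that gyr_closed by simp
  have aut: "magma_automorphism H (\<oplus>) (gyr a b)" if ab: "a \<in> H" "b \<in> H" for a b
  proof -
    have abG: "a \<in> G" "b \<in> G" using ab C by auto
    have "gyr a b ` H = H"
    proof (intro equalityI subsetI)
      fix y assume "y \<in> gyr a b ` H"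
      then show "y \<in> H" using gyr_eq abG ab C by (auto simp: subset_iff)
    next
      fix y assume y: "y \<in> H"
      let ?c = "neg b \<oplus> (neg a \<oplus> ((a \<oplus> b) \<oplus> y))"
      have c: "?c \<in> H" "y \<in> G" using y ab C by auto
      have "gyr a b ?c = y" using abG c by (subst gyr_eq) auto
      with c(1) show "y \<in> gyr a b ` H" by (metis imageI)
    qed
    moreover have "inj_on (gyr a b) H"
      using gyr_automorphism[OF abG] C
      by (meson bij_betw_def inj_on_subset magma_automorphism_def)
    ultimately show ?thesis
      using gyr_automorphism[OF abG] C
      by (auto simp: magma_automorphism_def bij_betw_def subset_iff)
  qed
  have "gyrogroup H (\<oplus>) gyr"
  proof
    show "\<exists>z\<in>H. (\<forall>a\<in>H. z \<oplus> a = a) \<and> (\<forall>a\<in>H. \<exists>b\<in>H. b \<oplus> a = z)"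
    proof (intro bexI conjI ballI)
      fix a assume a: "a \<in> H"
      then have "a \<in> G" using C by blast
      then show "neutral \<oplus> a = a" "neg a \<oplus> a = neutral" by simp_all
      show "neg a \<in> H" using C a by blast
    qed (use C in blast)
    show "a \<oplus> b \<in> H" if "a \<in> H" "b \<in> H" for a b using that C by blast
    show "a \<oplus> (b \<oplus> c) = a \<oplus> b \<oplus> gyr a b c" if "a \<in> H" "b \<in> H" "c \<in> H" for a b c
      using that C by (intro left_gyroassociative) auto
    show "gyr a b c = gyr (a \<oplus> b) b c" if "a \<in> H" "b \<in> H" "c \<in> H" for a b c
      using that C by (intro left_loop) auto
  qed (rule aut)
  then show ?S using C aut unfolding subgyrogroup_def by blast
qed

text \<open>
  Right cancellation inside a subgyrogroup, which gyroassociativity does not give directly: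
  the Bol identity recovers \<open>a\<close> from \<open>h \<oplus> (a \<oplus> h)\<close> by translating with \<open>neg h\<close> on both sides.
\<close>
lemma right_factor_in_subgyrogroup:
  assumes H: "subgyrogroup H G (\<oplus>) gyr" and "a \<in> G" "h \<in> H" "a \<oplus> h \<in> H"
  shows "a \<in> H"
proof -
  have hG: "h \<in> G" and H': "h \<oplus> (a \<oplus> h) \<in> H" "neg h \<in> H" using assms by (auto simp: subgyrogroup_iff)
  have "a = neg h \<oplus> (h \<oplus> (a \<oplus> (h \<oplus> neg h)))" using assms hG by simp
  also have "\<dots> = neg h \<oplus> ((h \<oplus> (a \<oplus> h)) \<oplus> neg h)"
    using assms hG by (subst Bol_identity) auto
  finally show ?thesis using H H' by (metis subgyrogroup_iff)
qed

section \<open>Divisibility of orders\<close>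

text \<open>A translate of \<open>H\<close> by an element outside \<open>H\<close> is disjoint from \<open>H\<close>.\<close>
lemma card_proper_subgyrogroup:
  assumes H: "subgyrogroup H G (\<oplus>) gyr" and fin: "finite G" and "H \<noteq> G"
  shows "2 * card H \<le> card G"
proof -
  have HG: "H \<subseteq> G" using H by (simp add: subgyrogroup_iff)
  obtain a where a: "a \<in> G" "a \<notin> H" using HG assms by blast
  have inj: "inj_on ((\<oplus>) a) H" using left_cancel[OF a(1)] HG unfolding inj_on_def by blast
  have "H \<inter> (\<oplus>) a ` H = {}" using right_factor_in_subgyrogroup[OF H a(1)] a by auto
  then have "card (H \<union> (\<oplus>) a ` H) = 2 * card H"
    using finite_subset[OF HG fin] card_image[OF inj] by (simp add: card_Un_disjoint)
  moreover have "card (H \<union> (\<oplus>) a ` H) \<le> card G"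
    using HG a by (intro card_mono fin) auto
  ultimately show ?thesis by simp
qed

text \<open>
  For such a subset, left translation is a group action; this is what the coset argument for
  Lagrange's theorem needs. Cyclic subgyrogroups and the left nucleus are of this kind.
\<close>
definition left_associating :: "'a set \<Rightarrow> bool" where
  "left_associating C \<longleftrightarrow> (\<forall>c\<in>C. \<forall>d\<in>C. \<forall>x\<in>G. (c \<oplus> d) \<oplus> x = c \<oplus> (d \<oplus> x))"

lemma left_associating_subset: "left_associating C \<Longrightarrow> D \<subseteq> C \<Longrightarrow> left_associating D"
  unfolding left_associating_def by blast

text \<open>
  Sandwiching both translations between two copies of the translation by \<open>x\<close> gives the same
  translation, and the sandwich can be undone.
\<close>
lemma right_cancel:
  assumes "a \<in> G" "b \<in> G" "x \<in> G" "a \<oplus> x = b \<oplus> x"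
  shows "a = b"
proof -
  have "ltr (x \<oplus> (a \<oplus> x)) = ltr (x \<oplus> (b \<oplus> x))" using assms by simp
  then have "ltr x \<circ> (ltr a \<circ> ltr x) = ltr x \<circ> (ltr b \<circ> ltr x)"
    using assms by (simp only: ltr_Bol)
  then have "ltr (neg x) \<circ> (ltr x \<circ> (ltr a \<circ> (ltr x \<circ> ltr (neg x))))
      = ltr (neg x) \<circ> (ltr x \<circ> (ltr b \<circ> (ltr x \<circ> ltr (neg x))))"
    by (metis comp_assoc)
  then have "ltr a = ltr b" using assms by simp
  then show ?thesis using ltr_inject assms by blast
qed

text \<open>\<open>C\<close> acts on \<open>H\<close> by left translation, and by right cancellation freely.\<close>
lemma card_left_associating_dvd:
  assumes C: "subgyrogroup C G (\<oplus>) gyr" and "left_associating C"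
    and H: "subgyrogroup H G (\<oplus>) gyr" and "C \<subseteq> H" and fin: "finite G"
  shows "card C dvd card H"
proof -
  have HG: "H \<subseteq> G" and CG: "C \<subseteq> G" using H C by (auto simp: subgyrogroup_iff)
  define R where "R = {(x, y). x \<in> H \<and> (\<exists>c\<in>C. y = c \<oplus> x)}"
  have act: "(c \<oplus> d) \<oplus> x = c \<oplus> (d \<oplus> x)" if "c \<in> C" "d \<in> C" "x \<in> H" for c d x
    using \<open>left_associating C\<close> that HG unfolding left_associating_def by blast
  have RH: "R \<subseteq> H \<times> H" using H \<open>C \<subseteq> H\<close> by (auto simp: R_def subgyrogroup_iff)
  have "equiv H R"
  proof (rule equivI)
    show "R \<subseteq> H \<times> H" by (fact RH)
    show "refl_on H R"
      using HG C by (auto simp: refl_on_def R_def subgyrogroup_iff subset_iff intro!: bexI[of _ neutral])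
    show "sym R"
    proof (rule symI)
      fix x y assume xy: "(x, y) \<in> R"
      then obtain c where c: "c \<in> C" "y = c \<oplus> x" "x \<in> H" by (auto simp: R_def)
      then have "x = neg c \<oplus> y" "neg c \<in> C" using HG CG C by (auto simp: subgyrogroup_iff subset_iff)
      then show "(y, x) \<in> R" using xy RH by (auto simp: R_def)
    qed
    show "trans R"
    proof (rule transI)
      fix x y w assume "(x, y) \<in> R" "(y, w) \<in> R"
      then obtain c d where "c \<in> C" "y = c \<oplus> x" "x \<in> H" "d \<in> C" "w = d \<oplus> y" by (auto simp: R_def)
      then have "w = (d \<oplus> c) \<oplus> x" "d \<oplus> c \<in> C" using act C by (auto simp: subgyrogroup_iff)
      then show "(x, w) \<in> R" using \<open>x \<in> H\<close> by (auto simp: R_def)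
    qed
  qed
  moreover have "card C dvd card X" if X: "X \<in> H // R" for X
  proof -
    obtain x where x: "x \<in> H" "X = R `` {x}" using X by (auto simp: quotient_def)
    then have "X = (\<lambda>c. c \<oplus> x) ` C" by (auto simp: R_def)
    moreover have "inj_on (\<lambda>c. c \<oplus> x) C" using right_cancel x CG HG unfolding inj_on_def by blast
    ultimately show ?thesis by (simp add: card_image)
  qed
  ultimately show ?thesis by (rule equiv_imp_dvd_card[OF finite_subset[OF HG fin]])
qed

section \<open>Cyclic subgyrogroups and the weak Cauchy property\<close>

definition multiple :: "nat \<Rightarrow> 'a \<Rightarrow> 'a" where
  "multiple n a = (ltr a ^^ n) neutral"

lemma multiple_closed [simp]: "a \<in> G \<Longrightarrow> multiple n a \<in> G"
  unfolding multiple_def by (induction n) (auto simp: ltr_def)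

lemma multiple_0 [simp]: "multiple 0 a = neutral"
  by (simp add: multiple_def)

lemma multiple_1 [simp]: "a \<in> G \<Longrightarrow> multiple (Suc 0) a = a"
  by (simp add: multiple_def)

text \<open>
  Gyrogroups are left power-associative: the Bol identity turns \<open>f f\<^sup>n f\<close> into a translation, so
  the induction advances by two.
\<close>
lemma ltr_multiple:
  assumes a: "a \<in> G"
  shows "ltr (multiple n a) = ltr a ^^ n"
proof (induction n rule: less_induct)
  case (less n)
  consider "n = 0" | "n = 1" | m where "n = Suc (Suc m)" by (metis One_nat_def not0_implies_Suc)
  then show ?case
  proof cases
    case (3 m)
    have pow: "ltr a ^^ n = ltr a \<circ> (ltr (multiple m a) \<circ> ltr a)"
      using less[of m] 3 by (simp only: funpow.simps(2)[of "Suc m"] funpow_Suc_right[of m])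
    also have "\<dots> = ltr (a \<oplus> (multiple m a \<oplus> a))" using a ltr_Bol by simp
    finally have eq: "ltr a ^^ n = ltr (a \<oplus> (multiple m a \<oplus> a))" .
    have "multiple n a = a \<oplus> (multiple m a \<oplus> a)"
      unfolding multiple_def[of n] eq using a by simp
    with eq show ?thesis by simp
  qed (use a in \<open>auto simp: ltr_neutral\<close>)
qed

lemma multiple_add:
  assumes "a \<in> G"
  shows "multiple m a \<oplus> multiple n a = multiple (m + n) a"
proof -
  have "multiple m a \<oplus> multiple n a = ltr (multiple m a) (multiple n a)"
    using assms by (simp add: ltr_def)
  then show ?thesis using assms by (simp only: ltr_multiple) (simp add: multiple_def funpow_add)
qed

lemma multiple_mult:
  assumes "a \<in> G"
  shows "multiple m (multiple n a) = multiple (n * m) a"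
  using assms by (simp add: multiple_def[of m] ltr_multiple funpow_mult)
     (simp add: multiple_def mult.commute)

text \<open>The least positive period divides all periods, by division with remainder.\<close>
lemma multiple_period:
  assumes "a \<in> G" "finite G"
  shows "\<exists>k>0. \<forall>n. multiple n a = neutral \<longleftrightarrow> k dvd n"
proof -
  have "\<not> inj (\<lambda>n. multiple n a)"
    using assms finite_subset[of "range (\<lambda>n. multiple n a)" G] finite_imageD
    by (metis image_subsetI infinite_UNIV_nat multiple_closed)
  then obtain i j where ij: "i < j" "multiple i a = multiple j a"
    unfolding inj_def by (metis linorder_neqE_nat)
  then have "multiple i a \<oplus> multiple (j - i) a = multiple i a \<oplus> neutral"
    using assms multiple_add[of a i "j - i"] by simp
  then have ex: "0 < j - i \<and> multiple (j - i) a = neutral"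
    using left_cancel[of "multiple i a"] ij assms by simp
  define k where "k = (LEAST k. 0 < k \<and> multiple k a = neutral)"
  have k: "0 < k" "multiple k a = neutral"
    using LeastI[of "\<lambda>k. 0 < k \<and> multiple k a = neutral", OF ex] by (auto simp: k_def)
  have least: "m = 0" if "m < k" "multiple m a = neutral" for m
    using not_less_Least[of m "\<lambda>k. 0 < k \<and> multiple k a = neutral"] that by (auto simp: k_def)
  have neu: "multiple m neutral = neutral" for m
    by (induction m) (auto simp: multiple_def ltr_neutral)
  have "multiple n a = neutral \<longleftrightarrow> k dvd n" for n
  proof -
    have "multiple n a = multiple (k * (n div k)) a \<oplus> multiple (n mod k) a"
      using assms by (simp add: multiple_add)
    also have "multiple (k * (n div k)) a = neutral"
      using multiple_mult[of a "n div k" k] assms k neu by simp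
    finally have "multiple n a = multiple (n mod k) a" using assms by simp
    then show ?thesis using least[of "n mod k"] k(1) by (metis dvd_eq_mod_eq_0 mod_less_divisor multiple_0)
  qed
  then show ?thesis using k by blast
qed

definition cyclic :: "'a \<Rightarrow> 'a set" where
  "cyclic a = range (\<lambda>n. multiple n a)"

lemma cyclic_self: "a \<in> G \<Longrightarrow> a \<in> cyclic a"
  unfolding cyclic_def using multiple_1 by (metis rangeI)

lemma cyclic_left_associating: "a \<in> G \<Longrightarrow> left_associating (cyclic a)"
proof (clarsimp simp: left_associating_def cyclic_def multiple_add)
  fix m n x assume a: "a \<in> G" and x: "x \<in> G"
  have "ltr (multiple (m + n) a) x = ltr (multiple m a) (ltr (multiple n a) x)"
    using a by (simp only: ltr_multiple) (simp add: funpow_add)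
  then show "multiple (m + n) a \<oplus> x = multiple m a \<oplus> (multiple n a \<oplus> x)"
    using a x by (simp add: ltr_def)
qed

lemma cyclic_least:
  assumes H: "subgyrogroup H G (\<oplus>) gyr" and a: "a \<in> H"
  shows "cyclic a \<subseteq> H"
proof -
  have "multiple n a \<in> H" for n
    unfolding multiple_def using H a by (induction n) (auto simp: subgyrogroup_iff ltr_def)
  then show ?thesis by (auto simp: cyclic_def)
qed

lemma cyclic_subgyrogroup:
  assumes a: "a \<in> G" and "finite G"
  shows "subgyrogroup (cyclic a) G (\<oplus>) gyr"
proof -
  obtain k where k: "k > 0" "\<And>n. multiple n a = neutral \<longleftrightarrow> k dvd n"
    using multiple_period[OF assms] by blast
  have "neg (multiple n a) = multiple (n * (k - 1)) a" for n
  proof (rule left_inverse_unique[of neutral "multiple n a"])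
    have "n * (k - 1) + n = k * n" using k(1) by (cases k) auto
    then show "multiple (n * (k - 1)) a \<oplus> multiple n a = neutral"
      using a k(2) by (simp add: multiple_add)
  qed (use a neutral_spec in auto)
  moreover have "neutral = multiple 0 a" by simp
  ultimately show ?thesis
    using a unfolding subgyrogroup_iff cyclic_def
    by (intro conjI) (auto simp: multiple_add simp del: multiple_0)
qed

lemma generated_eq_cyclic:
  assumes "a \<in> G" "finite G"
  shows "generated G (\<oplus>) gyr a = cyclic a"
  using generated_least[OF cyclic_subgyrogroup[OF assms] cyclic_self]
    cyclic_least[OF generated_subgyrogroup] assms by blast

lemma card_cyclic_dvd:
  assumes "subgyrogroup H G (\<oplus>) gyr" "a \<in> H" "finite G"
  shows "card (cyclic a) dvd card H"
proof -
  have "a \<in> G" using assms by (auto simp: subgyrogroup_iff)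
  then show ?thesis
    using card_left_associating_dvd[OF cyclic_subgyrogroup[of a] cyclic_left_associating[of a] assms(1)
        cyclic_least[OF assms(1,2)]] assms(3) by simp
qed

lemma card_cyclic:
  assumes a: "a \<in> G" and fin: "finite G" and k: "k > 0" "\<And>n. multiple n a = neutral \<longleftrightarrow> k dvd n"
  shows "card (cyclic a) = k"
proof -
  have eq: "multiple n a = multiple (n mod k) a" for n
  proof -
    have "multiple n a = multiple (k * (n div k)) a \<oplus> multiple (n mod k) a"
      using a by (simp add: multiple_add)
    also have "multiple (k * (n div k)) a = neutral" unfolding k(2) by simp
    finally show ?thesis using a by simp
  qed
  have "cyclic a = (\<lambda>n. multiple n a) ` {..<k}"
  proof (intro equalityI subsetI)
    fix x assume "x \<in> cyclic a"
    then obtain n where "x = multiple n a" by (auto simp: cyclic_def)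
    then have "x = multiple (n mod k) a" by (rule trans[OF _ eq])
    moreover have "n mod k \<in> {..<k}" using k(1) by simp
    ultimately show "x \<in> (\<lambda>n. multiple n a) ` {..<k}" by (rule image_eqI)
  qed (auto simp: cyclic_def)
  moreover have "inj_on (\<lambda>n. multiple n a) {..<k}"
  proof (rule linorder_inj_onI)
    fix i j assume ij: "i < j" "i \<in> {..<k}" "j \<in> {..<k}"
    show "multiple i a \<noteq> multiple j a"
    proof
      assume "multiple i a = multiple j a"
      then have "multiple i a \<oplus> multiple (j - i) a = multiple i a \<oplus> neutral"
        using a ij multiple_add[of a i "j - i"] by simp
      then have "multiple (j - i) a = neutral" using left_cancel[of "multiple i a"] a by simp
      then have "k dvd j - i" using k by simp
      then show False using ij by (auto dest: dvd_imp_le)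
    qed
  qed auto
  ultimately show ?thesis by (simp add: card_image)
qed

lemma multiple_card_cyclic:
  assumes "a \<in> G" "finite G"
  shows "card (cyclic a) > 0" "multiple n a = neutral \<longleftrightarrow> card (cyclic a) dvd n"
  using multiple_period[OF assms] card_cyclic[OF assms] by auto

text \<open>The order of any nonneutral \<open>a\<close> has the form \<open>p * m\<close>, so the \<open>m\<close>-th multiple of \<open>a\<close> has order \<open>p\<close>.\<close>
lemma prime_power_weak_Cauchy:
  fixes p :: nat
  assumes p: "prime p" and fin: "finite G" and card: "card G dvd p ^ n"
  shows "weak_Cauchy_property G (\<oplus>) gyr"
  unfolding weak_Cauchy_property_def
proof (intro conjI fin allI impI)
  fix q :: nat assume q: "prime q" "q dvd card G"
  have "q = p" using q p card
    by (meson dvd_trans prime_dvd_power primes_dvd_imp_eq)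
  have "card G \<noteq> 1" using q by auto
  then have "G \<noteq> {neutral}" by (metis is_singletonI is_singleton_altdef)
  then obtain a where a: "a \<in> G" "a \<noteq> neutral" using neutral_closed by blast
  define k where "k = card (cyclic a)"
  have k: "k > 0" "\<And>n. multiple n a = neutral \<longleftrightarrow> k dvd n"
    using multiple_card_cyclic[OF a(1) fin] by (auto simp: k_def)
  have "k \<noteq> 1" using k(2)[of "Suc 0"] a by auto
  moreover have "k dvd p ^ n"
    using card_cyclic_dvd[OF subgyrogroup_self a(1) fin] card unfolding k_def by (rule dvd_trans)
  ultimately have "p dvd k" using p by (metis divides_primepow_nat dvd_triv_left dvd_power neq0_conv power_0)
  then obtain m where m: "k = p * m" by blast
  then have "m > 0" using k by auto
  have "card (cyclic (multiple m a)) = p"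
  proof (rule card_cyclic)
    show "p > 0" using p prime_gt_0_nat by blast
    show "multiple n (multiple m a) = neutral \<longleftrightarrow> p dvd n" for n
      using a k(2) m \<open>m > 0\<close> by (simp add: multiple_mult mult.commute[of p])
  qed (use a fin in auto)
  then show "\<exists>a\<in>G. gyro_order G (\<oplus>) gyr a = q"
    using \<open>q = p\<close> a fin
    by (intro bexI[of _ "multiple m a"]) (auto simp: gyro_order_def generated_eq_cyclic)
qed

section \<open>Lagrange's theorem for orders dividing the square of a prime\<close>

text \<open>
  The sums \<open>c \<oplus> d\<close> are pairwise distinct: if \<open>c \<oplus> d = c' \<oplus> d'\<close>, then \<open>neg c' \<oplus> c\<close> moves \<open>d\<close> to
  \<open>d'\<close>, so it lies in \<open>D\<close> by right cancellation, and it also lies in \<open>C\<close>.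
\<close>
lemma card_product_le:
  assumes C: "subgyrogroup C G (\<oplus>) gyr" "left_associating C" and D: "subgyrogroup D G (\<oplus>) gyr"
    and H: "subgyrogroup H G (\<oplus>) gyr" "C \<subseteq> H" "D \<subseteq> H" and disj: "C \<inter> D = {neutral}"
    and fin: "finite G"
  shows "card C * card D \<le> card H"
proof -
  have sub: "H \<subseteq> G" "C \<subseteq> G" "D \<subseteq> G" using H C D by (auto simp: subgyrogroup_iff)
  have "inj_on (\<lambda>(c, d). c \<oplus> d) (C \<times> D)"
  proof (rule inj_onI, clarify)
    fix c d c' d' assume cd: "c \<in> C" "d \<in> D" "c' \<in> C" "d' \<in> D" and eq: "c \<oplus> d = c' \<oplus> d'"
    have G: "c \<in> G" "d \<in> G" "c' \<in> G" "d' \<in> G" using cd sub by auto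
    have nc: "neg c' \<in> C" and e: "neg c' \<oplus> c \<in> C" using C cd by (auto simp: subgyrogroup_iff)
    have "(neg c' \<oplus> c) \<oplus> d = neg c' \<oplus> (c \<oplus> d)"
      using C(2) nc cd G unfolding left_associating_def by blast
    then have "(neg c' \<oplus> c) \<oplus> d = d'" using eq G by simp
    then have "neg c' \<oplus> c \<in> D"
      using right_factor_in_subgyrogroup[OF D, of "neg c' \<oplus> c" d] cd G by simp
    then have "neg c' \<oplus> c = neutral" using e disj by blast
    then have "c = c'" using left_cancel[of "neg c'" c c'] G by simp
    then show "c = c' \<and> d = d'" using eq left_cancel G by blast
  qed
  then have "card C * card D = card ((\<lambda>(c, d). c \<oplus> d) ` (C \<times> D))"
    by (simp add: card_image card_cartesian_product)
  also have "\<dots> \<le> card H"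
    using H finite_subset[OF sub(1) fin]
    by (intro card_mono) (auto simp: subgyrogroup_iff dest!: subsetD)
  finally show ?thesis .
qed

text \<open>
  If \<open>H\<close> is not cyclic and contains no element of order \<open>p\<^sup>2\<close>, it contains two different cyclic
  subgyrogroups of order \<open>p\<close>, whose sums fill the whole gyrogroup.
\<close>
lemma Lagrange_prime_square:
  fixes p :: nat
  assumes p: "prime p" and fin: "finite G" and card: "card G dvd p ^ 2"
    and H: "subgyrogroup H G (\<oplus>) gyr"
  shows "card H dvd p ^ 2"
proof (cases "H = {neutral}")
  case False
  have HG: "H \<subseteq> G" "neutral \<in> H" using H by (auto simp: subgyrogroup_iff)
  have finH: "finite H" using HG fin finite_subset by blast
  have p1: "p > 1" using p prime_gt_1_nat by blast
  have cG: "card G \<le> p ^ 2" using card p1 by (intro dvd_imp_le) auto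
  have big: "card H dvd p ^ 2" if "p ^ 2 \<le> card H"
    using that cG card_mono[OF fin HG(1)] card by (metis le_antisym order_trans)
  have ord: "card (cyclic x) = p \<or> p ^ 2 \<le> card H" if x: "x \<in> H" "x \<noteq> neutral" for x
  proof -
    have xG: "x \<in> G" using x HG by blast
    have "card (cyclic x) dvd p ^ 2"
      using card_cyclic_dvd[OF subgyrogroup_self xG fin] card by (rule dvd_trans)
    then obtain i where i: "i \<le> 2" "card (cyclic x) = p ^ i" using p by (auto simp: divides_primepow_nat)
    have "card (cyclic x) \<noteq> 1"
      using multiple_card_cyclic(2)[OF xG fin, of "Suc 0"] x xG by auto
    then have "i \<noteq> 0" using i by (metis power_0)
    then have "i = 1 \<or> i = 2" using i(1) by linarith
    moreover have "card (cyclic x) \<le> card H" using cyclic_least[OF H x(1)] finH by (rule card_mono[rotated])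
    ultimately show ?thesis using i by auto
  qed
  obtain a where a: "a \<in> H" "a \<noteq> neutral" using False HG by blast
  have aG: "a \<in> G" using a HG by blast
  show ?thesis
  proof (cases "cyclic a = H")
    case True
    then show ?thesis using card_cyclic_dvd[OF subgyrogroup_self aG fin] card by (metis dvd_trans)
  next
    case False
    then obtain b where b: "b \<in> H" "b \<notin> cyclic a" using cyclic_least[OF H a(1)] by blast
    have bG: "b \<in> G" using b HG by blast
    have sa: "subgyrogroup (cyclic a) G (\<oplus>) gyr" and sb: "subgyrogroup (cyclic b) G (\<oplus>) gyr"
      using cyclic_subgyrogroup aG bG fin by auto
    have "b \<noteq> neutral" using b sa by (auto simp: subgyrogroup_iff)
    show ?thesis
    proof (cases "p ^ 2 \<le> card H")
      case True then show ?thesis by (rule big)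
    next
      case small: False
      then have pa: "card (cyclic a) = p" and pb: "card (cyclic b) = p"
        using ord a b \<open>b \<noteq> neutral\<close> by auto
      let ?I = "cyclic a \<inter> cyclic b"
      have sI: "subgyrogroup ?I G (\<oplus>) gyr" using sa sb by (auto simp: subgyrogroup_iff)
      have "card ?I dvd p"
        using card_left_associating_dvd[OF sI _ sa _ fin]
          left_associating_subset[OF cyclic_left_associating[OF aG]] pa by auto
      moreover have "card ?I \<noteq> p"
      proof
        assume I: "card ?I = p"
        have "finite (cyclic a)" "finite (cyclic b)" using pa pb p1 card.infinite by fastforce+
        then have "?I = cyclic a" and "?I = cyclic b"
          using card_subset_eq[of "cyclic a" ?I] card_subset_eq[of "cyclic b" ?I] I pa pb
          by (metis Int_lower1, metis Int_lower2)
        then show False using b cyclic_self[OF bG] by blast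
      qed
      ultimately have "card ?I = 1" using p prime_nat_iff by blast
      moreover have "neutral \<in> ?I" using sI by (simp add: subgyrogroup_iff)
      ultimately have "?I = {neutral}" by (metis card_1_singletonE singletonD)
      then have "p * p \<le> card H"
        using card_product_le[OF sa cyclic_left_associating[OF aG] sb H
            cyclic_least[OF H a(1)] cyclic_least[OF H b(1)] _ fin]
          pa pb by simp
      then show ?thesis using small by (simp add: power2_eq_square)
    qed
  qed
qed auto

section \<open>The left nucleus\<close>

definition left_nucleus :: "'a set" where
  "left_nucleus = {n \<in> G. \<forall>x\<in>G. \<forall>y\<in>G. n \<oplus> (x \<oplus> y) = (n \<oplus> x) \<oplus> y}"

lemma left_nucleus_iff_ltr:
  "n \<in> left_nucleus \<longleftrightarrow> n \<in> G \<and> (\<forall>x\<in>G. ltr n \<circ> ltr x \<in> ltr ` G)"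
proof (intro iffI conjI ballI)
  fix x assume n: "n \<in> left_nucleus" and x: "x \<in> G"
  then have "ltr n \<circ> ltr x = ltr (n \<oplus> x)" "n \<oplus> x \<in> G"
    by (auto simp: left_nucleus_def ltr_def fun_eq_iff)
  then show "ltr n \<circ> ltr x \<in> ltr ` G" by blast
next
  assume n: "n \<in> G \<and> (\<forall>x\<in>G. ltr n \<circ> ltr x \<in> ltr ` G)"
  have "n \<oplus> (x \<oplus> y) = (n \<oplus> x) \<oplus> y" if xy: "x \<in> G" "y \<in> G" for x y
  proof -
    obtain u where u: "u \<in> G" "ltr n \<circ> ltr x = ltr u" using n xy by blast
    have "u = n \<oplus> x" using fun_cong[OF u(2), of neutral] n xy u by (simp add: ltr_def)
    then show ?thesis using fun_cong[OF u(2), of y] n xy by (simp add: ltr_def)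
  qed
  then show "n \<in> left_nucleus" using n by (simp add: left_nucleus_def)
qed (simp add: left_nucleus_def)

lemma left_nucleus_from_ltr:
  assumes "\<And>x. x \<in> G \<Longrightarrow> f \<circ> ltr x \<in> ltr ` G"
  shows "\<exists>n\<in>left_nucleus. f = ltr n"
proof -
  have "f \<in> ltr ` G" using assms[of neutral] by (simp add: ltr_neutral)
  then show ?thesis using assms left_nucleus_iff_ltr by blast
qed

lemma left_nucleus_assoc:
  "\<lbrakk>n \<in> left_nucleus; x \<in> G; y \<in> G\<rbrakk> \<Longrightarrow> (n \<oplus> x) \<oplus> y = n \<oplus> (x \<oplus> y)"
  by (simp add: left_nucleus_def)

lemma left_nucleus_subgyrogroup: "subgyrogroup left_nucleus G (\<oplus>) gyr"
proof -
  have NG: "n \<in> G" if "n \<in> left_nucleus" for n using that by (simp add: left_nucleus_def)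
  have "a \<oplus> b \<in> left_nucleus" if "a \<in> left_nucleus" "b \<in> left_nucleus" for a b
    unfolding left_nucleus_def using that NG by (simp add: left_nucleus_assoc)
  moreover have "neg a \<in> left_nucleus" if a: "a \<in> left_nucleus" for a
  proof -
    have aG: "a \<in> G" using a NG by blast
    have "neg a \<oplus> (x \<oplus> y) = (neg a \<oplus> x) \<oplus> y" if xy: "x \<in> G" "y \<in> G" for x y
    proof (rule left_cancel[of a])
      show "a \<oplus> (neg a \<oplus> (x \<oplus> y)) = a \<oplus> ((neg a \<oplus> x) \<oplus> y)"
        using aG xy a by (simp flip: left_nucleus_assoc)
    qed (use aG xy in auto)
    then show ?thesis using aG by (simp add: left_nucleus_def)
  qed
  ultimately show ?thesis unfolding subgyrogroup_iff
    by (auto simp: left_nucleus_def)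
qed

lemma left_nucleus_left_associating: "left_associating left_nucleus"
  unfolding left_associating_def left_nucleus_def by auto

text \<open>
  Every translation \<open>x\<close> can be written as \<open>a y a\<close> with a translation \<open>y\<close>, and then
  \<open>(a n a\<^sup>-\<^sup>1) x = a (n y) a\<close> is a sandwich and hence a translation.
\<close>
lemma left_nucleus_conjugate:
  assumes a: "a \<in> G" and n: "n \<in> left_nucleus"
  shows "\<exists>m\<in>left_nucleus. ltr a \<circ> (ltr n \<circ> ltr (neg a)) = ltr m"
proof (rule left_nucleus_from_ltr)
  fix x assume x: "x \<in> G"
  obtain y where y: "y \<in> G" "ltr (neg a) \<circ> (ltr x \<circ> ltr (neg a)) = ltr y"
    using ltr_sandwich[of "neg a" "ltr x"] a x by auto
  have "ltr n \<circ> ltr y \<in> ltr ` G" using n y left_nucleus_iff_ltr by blast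
  then have "ltr a \<circ> (ltr n \<circ> ltr y \<circ> ltr a) \<in> ltr ` G" by (rule ltr_sandwich[OF a])
  also have "ltr a \<circ> (ltr n \<circ> ltr y \<circ> ltr a) = ltr a \<circ> (ltr n \<circ> ltr (neg a)) \<circ> ltr x"
    using a by (simp add: y(2)[symmetric] comp_assoc)
  finally show "ltr a \<circ> (ltr n \<circ> ltr (neg a)) \<circ> ltr x \<in> ltr ` G" .
qed

lemma left_nucleus_normal:
  assumes a: "a \<in> G" and n: "n \<in> left_nucleus"
  shows "\<exists>m\<in>left_nucleus. \<forall>x\<in>G. a \<oplus> (n \<oplus> x) = m \<oplus> (a \<oplus> x)"
proof -
  obtain m where m: "m \<in> left_nucleus" "ltr a \<circ> (ltr n \<circ> ltr (neg a)) = ltr m"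
    using left_nucleus_conjugate[OF assms] by blast
  have "a \<oplus> (n \<oplus> x) = m \<oplus> (a \<oplus> x)" if x: "x \<in> G" for x
    using fun_cong[OF m(2), of "a \<oplus> x"] a x n m(1) by (simp add: ltr_def left_nucleus_def)
  then show ?thesis using m by blast
qed

section \<open>Trivial left nucleus and gyrocommutativity\<close>

text \<open>
  The right-hand side is the gyration of \<open>(a, b)\<close> conjugating the translation by \<open>w\<close>, so it is the
  translation by \<open>v = gyr a b w\<close>. The left-hand side is its reversal. Multiplied on the right by
  the inverse translation, the right-hand side is a word with value 1, and the reversal of that word maps
  translations to translations, because inserting a factor 1 turns the product into a palindrome.
\<close>
lemma conjugate_by_reversed_word:
  assumes N: "left_nucleus = {neutral}" and a: "a \<in> G" and b: "b \<in> G" and w: "w \<in> G"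
  defines "c \<equiv> a \<oplus> b"
  shows "ltr c \<circ> (ltr (neg a) \<circ> (ltr (neg b) \<circ> (ltr w \<circ> (ltr b \<circ> (ltr a \<circ> ltr (neg c))))))
       = ltr (neg c) \<circ> (ltr a \<circ> (ltr b \<circ> (ltr w \<circ> (ltr (neg b) \<circ> (ltr (neg a) \<circ> ltr c)))))"
    (is "?k = ?l")
proof -
  define v where "v = gyr a b w"
  have c: "c \<in> G" and v: "v \<in> G" using a b w gyr_closed by (auto simp: c_def v_def)
  define g where "g = ltr (neg c) \<circ> (ltr a \<circ> ltr b)"
  have g: "g x = (if x \<in> G then gyr a b x else x)" for x
    using a b left_gyroassociative[of a b x] gyr_closed[of a b x] by (auto simp: g_def ltr_def c_def)
  have gw: "g \<circ> ltr w = ltr v \<circ> g"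
    using gyr_automorphism[OF a b] w gyr_closed[OF a b]
    by (auto simp: fun_eq_iff g ltr_def v_def magma_automorphism_def)
  have "?l = g \<circ> ltr w \<circ> (ltr (neg b) \<circ> (ltr (neg a) \<circ> ltr c))" by (simp add: g_def comp_assoc)
  also have "\<dots> = ltr v" using a b c by (simp add: gw) (simp add: g_def comp_assoc)
  finally have l: "?l = ltr v" .
  have "\<exists>n\<in>left_nucleus. ltr (neg v) \<circ> ?k = ltr n"
  proof (rule left_nucleus_from_ltr)
    fix x assume x: "x \<in> G"
    let ?s = "\<lambda>u f. ltr u \<circ> (f \<circ> ltr u)"
    have "?s (neg v) (?s c (?s (neg a) (?s (neg b) (?s w (?s b (?s a (?s (neg c) (ltr x)))))))) \<in> ltr ` G"
      using a b c w v x by (intro ltr_sandwich) auto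
    also have "?s (neg v) (?s c (?s (neg a) (?s (neg b) (?s w (?s b (?s a (?s (neg c) (ltr x))))))))
        = ltr (neg v) \<circ> (?k \<circ> (ltr x \<circ> (?l \<circ> ltr (neg v))))"
      by (simp only: comp_assoc)
    also have "\<dots> = ltr (neg v) \<circ> ?k \<circ> ltr x"
      using v by (simp only: l ltr_neg_cancel comp_id comp_assoc)
    finally show "ltr (neg v) \<circ> ?k \<circ> ltr x \<in> ltr ` G" .
  qed
  then have "ltr (neg v) \<circ> ?k = id" using N by (auto simp: ltr_neutral)
  then have "ltr v \<circ> (ltr (neg v) \<circ> ?k) = ltr v" by simp
  then show ?thesis using l v by (simp only: ltr_neg_cancel)
qed

text \<open>
  The two conjugations of the preceding lemma agree, so \<open>\<zeta> = b a c\<^sup>-\<^sup>2 a b\<close>, the quotient of the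
  conjugating elements, is central; being a palindrome, it is also a translation. In odd order
  it is \<open>h\<^sup>2\<close> for a central translation \<open>h\<close>, and \<open>h\<^sup>2 w = h w h\<close> puts it into the left nucleus.
\<close>
lemma trivial_left_nucleus_imp_gyrocommutative:
  assumes N: "left_nucleus = {neutral}" and fin: "finite G" and odd: "odd (card G)"
  shows "gyrocommutative G (\<oplus>) gyr"
  unfolding gyrocommutative_def
proof (intro ballI)
  fix a b assume a: "a \<in> G" and b: "b \<in> G"
  define c where "c = a \<oplus> b"
  have c: "c \<in> G" using a b by (simp add: c_def)
  define \<zeta> where "\<zeta> = ltr b \<circ> (ltr a \<circ> (ltr (neg c) \<circ> (ltr (neg c) \<circ> (ltr a \<circ> ltr b))))"
  have "ltr b \<circ> ((ltr a \<circ> ((ltr (neg c) \<circ> (ltr neutral \<circ> ltr (neg c))) \<circ> ltr a)) \<circ> ltr b) \<in> ltr ` G"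
    using a b c by (intro ltr_sandwich) auto
  then have "\<zeta> \<in> ltr ` G" by (simp only: ltr_neutral id_comp comp_assoc \<zeta>_def)
  then obtain f where f: "f \<in> G" "\<zeta> = ltr f" by blast
  have central: "\<zeta> \<circ> ltr w = ltr w \<circ> \<zeta>" if w: "w \<in> G" for w
  proof -
    \<comment> \<open>\<open>?p'\<close> and \<open>?q'\<close> are the inverses of \<open>?p\<close> and \<open>?q\<close>, and \<open>\<zeta>\<close> is \<open>?p\<close> followed on the right by \<open>?q\<close>.\<close>
    let ?p = "ltr b \<circ> (ltr a \<circ> ltr (neg c))" and ?q = "ltr (neg c) \<circ> (ltr a \<circ> ltr b)"
    let ?p' = "ltr c \<circ> (ltr (neg a) \<circ> ltr (neg b))" and ?q' = "ltr (neg b) \<circ> (ltr (neg a) \<circ> ltr c)"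
    have "?p' \<circ> (ltr w \<circ> ?p) = ?q \<circ> (ltr w \<circ> ?q')"
      using conjugate_by_reversed_word[OF N a b w] by (simp only: comp_assoc c_def)
    then have "?p \<circ> (?p' \<circ> (ltr w \<circ> ?p)) \<circ> ?q = ?p \<circ> (?q \<circ> (ltr w \<circ> ?q')) \<circ> ?q" by simp
    then show ?thesis using a b c by (simp add: comp_assoc \<zeta>_def)
  qed
  define k where "k = card (cyclic f)"
  have "k dvd card G" using card_cyclic_dvd[OF subgyrogroup_self f(1) fin] by (simp add: k_def)
  then have "odd k" using odd by (meson dvd_trans)
  then obtain j where j: "k = 2 * j + 1" by (rule oddE)
  define h where "h = multiple (Suc j) f"
  have h: "h \<in> G" using f by (simp add: h_def)
  have "ltr (multiple k f) = id"
    using multiple_card_cyclic(2)[OF f(1) fin, of k] by (simp add: k_def ltr_neutral)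
  then have fk: "ltr f ^^ k = id" using ltr_multiple[OF f(1)] by simp
  have hh: "ltr h \<circ> ltr h = \<zeta>"
  proof -
    have "ltr h \<circ> ltr h = ltr f ^^ (Suc j + Suc j)" using f by (simp only: h_def ltr_multiple funpow_add)
    also have "Suc j + Suc j = Suc k" using j by simp
    finally show ?thesis by (simp only: funpow.simps fk comp_id f)
  qed
  have hw: "ltr h \<circ> ltr w = ltr w \<circ> ltr h" if w: "w \<in> G" for w
  proof -
    have "(ltr f ^^ i) \<circ> ltr w = ltr w \<circ> (ltr f ^^ i)" for i
    proof (induction i)
      case (Suc i)
      have "(ltr f ^^ Suc i) \<circ> ltr w = ltr f \<circ> ((ltr f ^^ i) \<circ> ltr w)" by (simp add: comp_assoc)
      also have "\<dots> = (ltr f \<circ> ltr w) \<circ> (ltr f ^^ i)" by (simp only: Suc comp_assoc)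
      also have "\<dots> = ltr w \<circ> (ltr f ^^ Suc i)"
        using central[OF w] f by (simp add: comp_assoc)
      finally show ?case .
    qed simp
    then show ?thesis using f by (simp only: h_def ltr_multiple)
  qed
  have "ltr f \<circ> ltr w \<in> ltr ` G" if w: "w \<in> G" for w
  proof -
    have "ltr f \<circ> ltr w = ltr h \<circ> (ltr h \<circ> ltr w)" using hh f by (simp only: comp_assoc[symmetric])
    also have "\<dots> = ltr h \<circ> (ltr w \<circ> ltr h)" by (simp only: hw[OF w])
    finally show ?thesis using ltr_sandwich[of h "ltr w"] h w by auto
  qed
  then have "f \<in> left_nucleus" using f left_nucleus_iff_ltr by blast
  then have "\<zeta> = id" using N f by (simp add: ltr_neutral)
  \<comment> \<open>Undoing the outer factors of \<open>\<zeta> = 1\<close> leads to \<open>c\<^sup>2 = a b\<^sup>2 a\<close>, which is evaluated at the neutral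
    element by applying \<open>c = a b\<^sup>2 a c\<^sup>-\<^sup>1\<close> to \<open>c\<close>.\<close>
  have "ltr c \<circ> (ltr (neg a) \<circ> (ltr (neg b) \<circ> (\<zeta> \<circ> (ltr (neg b) \<circ> (ltr (neg a) \<circ> ltr c))))) = id"
    using a b c by (simp add: \<zeta>_def comp_assoc)
  then have "ltr c \<circ> (ltr (neg a) \<circ> (ltr (neg b) \<circ> (ltr (neg b) \<circ> (ltr (neg a) \<circ> ltr c)))) = id"
    using \<open>\<zeta> = id\<close> by simp
  then have "ltr a \<circ> (ltr b \<circ> (ltr b \<circ> (ltr a \<circ> (ltr (neg c) \<circ>
      (ltr c \<circ> (ltr (neg a) \<circ> (ltr (neg b) \<circ> (ltr (neg b) \<circ> (ltr (neg a) \<circ> ltr c)))))))))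
     = ltr a \<circ> (ltr b \<circ> (ltr b \<circ> (ltr a \<circ> (ltr (neg c) \<circ> id))))" by simp
  then have "ltr c = ltr a \<circ> (ltr b \<circ> (ltr b \<circ> (ltr a \<circ> ltr (neg c))))" using a b c by simp
  then have "ltr c c = (ltr a \<circ> (ltr b \<circ> (ltr b \<circ> (ltr a \<circ> ltr (neg c))))) c" by simp
  then have "c \<oplus> c = a \<oplus> (b \<oplus> (b \<oplus> a))" using a b c by (simp add: ltr_def)
  also have "\<dots> = c \<oplus> gyr a b (b \<oplus> a)" using a b left_gyroassociative[of a b "b \<oplus> a"] by (simp add: c_def)
  finally show "a \<oplus> b = gyr a b (b \<oplus> a)"
    using left_cancel[of c c "gyr a b (b \<oplus> a)"] a b c gyr_closed by (simp add: c_def)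
qed

section \<open>The quotient by the left nucleus\<close>

text \<open>
  A gyration is determined by the operation and inverses, and inverses of elements with equal
  images have equal images. So gyrations descend to the image; finiteness makes the induced
  surjections bijective.
\<close>
lemma homomorphic_image_gyrogroup:
  fixes \<phi> :: "'a \<Rightarrow> 'b" and prd :: "'b \<Rightarrow> 'b \<Rightarrow> 'b"
  assumes fin: "finite G"
    and hom: "\<And>x y. \<lbrakk>x \<in> G; y \<in> G\<rbrakk> \<Longrightarrow> \<phi> (x \<oplus> y) = prd (\<phi> x) (\<phi> y)"
  shows "\<exists>g. gyrogroup (\<phi> ` G) prd g"
proof -
  have neg_eq: "\<phi> (neg x) = \<phi> (neg y)" if xy: "x \<in> G" "y \<in> G" "\<phi> x = \<phi> y" for x y
  proof -
    have "\<phi> (neg x) = \<phi> (neg x \<oplus> (y \<oplus> neg y))" using xy by simp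
    also have "\<dots> = prd (\<phi> (neg x)) (prd (\<phi> x) (\<phi> (neg y)))" using xy by (simp only: hom closed neg_closed)
    also have "\<dots> = \<phi> (neg x \<oplus> (x \<oplus> neg y))" using xy by (simp only: hom closed neg_closed)
    finally show ?thesis using xy by simp
  qed
  have gyr_eq: "\<phi> (gyr a b c) = prd (\<phi> (neg (a \<oplus> b))) (prd (\<phi> a) (prd (\<phi> b) (\<phi> c)))"
    if abc: "a \<in> G" "b \<in> G" "c \<in> G" for a b c
  proof -
    have "gyr a b c = neg (a \<oplus> b) \<oplus> (a \<oplus> (b \<oplus> c))"
      using left_gyroassociative[of a b c] abc gyr_closed by simp
    then show ?thesis using abc by (simp only: hom closed neg_closed)
  qed
  \<comment> \<open>The gyration on the image is computed on representatives; \<open>g\<close> below says that the choice is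
    immaterial.\<close>
  define s where "s = inv_into G \<phi>"
  define g where "g A B C = \<phi> (gyr (s A) (s B) (s C))" for A B C
  have s: "s A \<in> G" "\<phi> (s A) = A" if "A \<in> \<phi> ` G" for A
    using that by (auto simp: s_def inv_into_into f_inv_into_f)
  have g: "g (\<phi> a) (\<phi> b) (\<phi> c) = \<phi> (gyr a b c)" if abc: "a \<in> G" "b \<in> G" "c \<in> G" for a b c
  proof -
    have S: "s (\<phi> a) \<in> G" "s (\<phi> b) \<in> G" "s (\<phi> c) \<in> G"
      "\<phi> (s (\<phi> a)) = \<phi> a" "\<phi> (s (\<phi> b)) = \<phi> b" "\<phi> (s (\<phi> c)) = \<phi> c"
      using abc s by auto
    have "\<phi> (neg (s (\<phi> a) \<oplus> s (\<phi> b))) = \<phi> (neg (a \<oplus> b))"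
      by (rule neg_eq) (use S abc hom in auto)
    then show ?thesis using S abc by (simp add: g_def gyr_eq)
  qed
  have "gyrogroup (\<phi> ` G) prd g"
  proof
    show "prd A B \<in> \<phi> ` G" if "A \<in> \<phi> ` G" "B \<in> \<phi> ` G" for A B
      using that by (auto simp flip: hom)
    have "prd (\<phi> (neg a)) (\<phi> a) = \<phi> neutral" if "a \<in> G" for a using that by (simp flip: hom)
    then have "\<exists>B\<in>\<phi> ` G. prd B (\<phi> a) = \<phi> neutral" if "a \<in> G" for a
      using that neg_closed[OF that] by blast
    then have "\<forall>A\<in>\<phi> ` G. \<exists>B\<in>\<phi> ` G. prd B A = \<phi> neutral" by blast
    moreover have "\<forall>A\<in>\<phi> ` G. prd (\<phi> neutral) A = A" by (auto simp flip: hom)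
    moreover have "\<phi> neutral \<in> \<phi> ` G" by simp
    ultimately show "\<exists>z\<in>\<phi> ` G. (\<forall>A\<in>\<phi> ` G. prd z A = A) \<and> (\<forall>A\<in>\<phi> ` G. \<exists>B\<in>\<phi> ` G. prd B A = z)"
      by (intro bexI[of _ "\<phi> neutral"] conjI)
    fix A B C assume "A \<in> \<phi> ` G" "B \<in> \<phi> ` G" "C \<in> \<phi> ` G"
    then obtain a b c where abc: "a \<in> G" "b \<in> G" "c \<in> G" "A = \<phi> a" "B = \<phi> b" "C = \<phi> c"
      by blast
    have "prd A (prd B C) = \<phi> (a \<oplus> (b \<oplus> c))" using abc by (simp add: hom)
    also have "a \<oplus> (b \<oplus> c) = (a \<oplus> b) \<oplus> gyr a b c" using abc by (intro left_gyroassociative)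
    also have "\<phi> \<dots> = prd (prd A B) (g A B C)" using abc by (simp add: g hom gyr_closed)
    finally show "prd A (prd B C) = prd (prd A B) (g A B C)" .
    have "g A B C = \<phi> (gyr a b c)" using abc g by simp
    also have "gyr a b c = gyr (a \<oplus> b) b c" using abc by (intro left_loop)
    also have "\<phi> \<dots> = g (\<phi> (a \<oplus> b)) B C" using abc g[of "a \<oplus> b" b c] by simp
    finally show "g A B C = g (prd A B) B C" using abc hom by simp
  next
    show "magma_automorphism (\<phi> ` G) prd (g A B)" if AB: "A \<in> \<phi> ` G" "B \<in> \<phi> ` G" for A B
    proof -
      obtain a b where ab: "a \<in> G" "A = \<phi> a" "b \<in> G" "B = \<phi> b" using AB by blast
      have onto: "gyr a b ` G = G" and gh: "\<And>x y. x \<in> G \<Longrightarrow> y \<in> G \<Longrightarrow> gyr a b (x \<oplus> y) = gyr a b x \<oplus> gyr a b y"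
        using gyr_automorphism[of a b] ab by (auto simp: magma_automorphism_def bij_betw_def)
      have "g A B ` \<phi> ` G = \<phi> ` gyr a b ` G" using ab g by (auto simp: image_image intro!: image_cong)
      then have im: "g A B ` \<phi> ` G = \<phi> ` G" by (simp add: onto)
      have "inj_on (g A B) (\<phi> ` G)" by (rule eq_card_imp_inj_on) (use fin im in auto)
      moreover have "g A B (prd (\<phi> x) (\<phi> y)) = prd (g A B (\<phi> x)) (g A B (\<phi> y))"
        if "x \<in> G" "y \<in> G" for x y
        using that ab gh gyr_closed[of a b] by (simp add: g flip: hom)
      ultimately show ?thesis using im by (auto simp: magma_automorphism_def bij_betw_def)
    qed
  qed
  then show ?thesis by blast
qed

definition coset :: "'a \<Rightarrow> 'a set" where
  "coset x = (\<lambda>n. n \<oplus> x) ` left_nucleus"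

definition set_sum :: "'a set \<Rightarrow> 'a set \<Rightarrow> 'a set" where
  "set_sum X Y = {x \<oplus> y | x y. x \<in> X \<and> y \<in> Y}"

text \<open>Normality moves the element of the left nucleus in \<open>x \<oplus> (n \<oplus> y)\<close> to the front.\<close>
lemma coset_hom:
  assumes x: "x \<in> G" and y: "y \<in> G"
  shows "coset (x \<oplus> y) = set_sum (coset x) (coset y)"
proof (intro equalityI subsetI)
  have NG: "\<And>n. n \<in> left_nucleus \<Longrightarrow> n \<in> G" "neutral \<in> left_nucleus"
    and clo: "\<And>m n. m \<in> left_nucleus \<Longrightarrow> n \<in> left_nucleus \<Longrightarrow> m \<oplus> n \<in> left_nucleus"
    using left_nucleus_subgyrogroup by (auto simp: subgyrogroup_iff)
  {
    fix z assume "z \<in> coset (x \<oplus> y)"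
    then obtain n where n: "n \<in> left_nucleus" "z = n \<oplus> (x \<oplus> y)" by (auto simp: coset_def)
    have "z = (n \<oplus> x) \<oplus> (neutral \<oplus> y)" using n x y by (simp add: left_nucleus_assoc)
    then show "z \<in> set_sum (coset x) (coset y)" using n NG by (auto simp: set_sum_def coset_def)
  next
    fix z assume "z \<in> set_sum (coset x) (coset y)"
    then obtain m n where mn: "m \<in> left_nucleus" "n \<in> left_nucleus" "z = (m \<oplus> x) \<oplus> (n \<oplus> y)"
      by (auto simp: set_sum_def coset_def)
    obtain n' where n': "n' \<in> left_nucleus" "x \<oplus> (n \<oplus> y) = n' \<oplus> (x \<oplus> y)"
      using left_nucleus_normal[OF x mn(2)] y by blast
    have "z = m \<oplus> (n' \<oplus> (x \<oplus> y))" using mn n' NG x y by (simp add: left_nucleus_assoc)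
    also have "\<dots> = (m \<oplus> n') \<oplus> (x \<oplus> y)" using mn n' NG x y by (simp add: left_nucleus_assoc)
    finally show "z \<in> coset (x \<oplus> y)" using clo mn n' by (auto simp: coset_def)
  }
qed

lemma coset_eq_iff:
  assumes x: "x \<in> G" and y: "y \<in> G"
  shows "coset x = coset y \<longleftrightarrow> x \<in> coset y"
proof
  note N = left_nucleus_subgyrogroup[unfolded subgyrogroup_iff]
  assume "coset x = coset y"
  moreover have "x \<in> coset x" using N x by (auto simp: coset_def intro!: image_eqI[of _ _ neutral])
  ultimately show "x \<in> coset y" by simp
next
  note N = left_nucleus_subgyrogroup[unfolded subgyrogroup_iff]
  assume "x \<in> coset y"
  then obtain n where n: "n \<in> left_nucleus" "x = n \<oplus> y" by (auto simp: coset_def)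
  have nG: "n \<in> G" "neg n \<in> left_nucleus" using N n by auto
  have "m \<oplus> x = (m \<oplus> n) \<oplus> y" if "m \<in> left_nucleus" for m
    using that n nG y by (simp add: left_nucleus_assoc)
  moreover have "m \<oplus> y = (m \<oplus> neg n) \<oplus> x" if "m \<in> left_nucleus" for m
    using that n nG x y by (simp add: left_nucleus_assoc[of m])
  ultimately show "coset x = coset y"
    using N n nG unfolding coset_def by (blast intro: image_eqI)
qed

text \<open>
  The elements of \<open>H\<close> in the coset of \<open>h\<close> are the \<open>n \<oplus> h\<close> with \<open>n\<close> in the left nucleus and,
  by right cancellation, in \<open>H\<close>.
\<close>
lemma card_coset_image:
  assumes H: "subgyrogroup H G (\<oplus>) gyr" and fin: "finite G"
  shows "card H = card (left_nucleus \<inter> H) * card (coset ` H)"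
proof -
  note N = left_nucleus_subgyrogroup[unfolded subgyrogroup_iff]
  have HG: "H \<subseteq> G" and finH: "finite H"
    using H finite_subset[OF _ fin] by (auto simp: subgyrogroup_iff)
  have "card {x \<in> H. coset x = coset h} = card (left_nucleus \<inter> H)" if h: "h \<in> H" for h
  proof -
    have hG: "h \<in> G" using h HG by blast
    have "{x \<in> H. coset x = coset h} = (\<lambda>n. n \<oplus> h) ` (left_nucleus \<inter> H)"
    proof (intro equalityI subsetI)
      fix x assume x: "x \<in> {x \<in> H. coset x = coset h}"
      then have "x \<in> coset h" using coset_eq_iff hG HG by blast
      then obtain n where n: "n \<in> left_nucleus" "x = n \<oplus> h" by (auto simp: coset_def)
      then have "n \<in> H" using right_factor_in_subgyrogroup[OF H, of n h] N x h by auto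
      then show "x \<in> (\<lambda>n. n \<oplus> h) ` (left_nucleus \<inter> H)" using n by blast
    next
      fix x assume "x \<in> (\<lambda>n. n \<oplus> h) ` (left_nucleus \<inter> H)"
      then have "x \<in> H" "x \<in> coset h" using H h by (auto simp: coset_def subgyrogroup_iff)
      then show "x \<in> {x \<in> H. coset x = coset h}" using coset_eq_iff[of x h] hG HG by auto
    qed
    moreover have "inj_on (\<lambda>n. n \<oplus> h) (left_nucleus \<inter> H)"
      using right_cancel hG HG unfolding inj_on_def by blast
    ultimately show ?thesis by (simp add: card_image)
  qed
  then have "card {x \<in> H. coset x = y} = card (left_nucleus \<inter> H)" if "y \<in> coset ` H" for y
    using that by blast
  then have "(\<Sum>y\<in>coset ` H. card {x \<in> H. coset x = y}) = card (left_nucleus \<inter> H) * card (coset ` H)"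
    by simp
  then show ?thesis using sum.image_gen[OF finH, of "\<lambda>_. 1::nat" coset] by simp
qed

section \<open>Subgyrogroups of order a power of the prime\<close>

text \<open>
  The order of the left nucleus is divisible by \<open>p\<close>, so the quotient has order dividing \<open>p\<^sup>2\<close>; the
  parts of \<open>H\<close> inside the left nucleus and in the quotient are handled separately.
\<close>
lemma Lagrange_prime_cube_odd:
  fixes p :: nat
  assumes p: "prime p" "odd p" and card: "card G = p ^ 3"
    and nc: "\<not> gyrocommutative G (\<oplus>) gyr" and H: "subgyrogroup H G (\<oplus>) gyr"
  shows "\<exists>i. card H = p ^ i"
proof -
  note N = left_nucleus_subgyrogroup
  have fin: "finite G" using card p(1) by (metis card.infinite power_eq_0_iff not_prime_0)
  have sub: "H \<subseteq> G" "left_nucleus \<subseteq> G" "neutral \<in> left_nucleus" using H N by (auto simp: subgyrogroup_iff)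
  have "card left_nucleus dvd p ^ 3"
    using card_left_associating_dvd[OF N left_nucleus_left_associating subgyrogroup_self sub(2) fin] card by simp
  then obtain j where j: "card left_nucleus = p ^ j" using p by (auto simp: divides_primepow_nat)
  have "left_nucleus \<noteq> {neutral}"
    using trivial_left_nucleus_imp_gyrocommutative[OF _ fin] nc card p by auto
  then have "card left_nucleus \<noteq> 1" using sub by (auto simp: card_1_singleton_iff)
  then have "j \<noteq> 0" using j by auto
  then have "p dvd card left_nucleus" using j by simp
  then obtain m where m: "card left_nucleus = p * m" by blast
  have "p ^ 3 = card left_nucleus * card (coset ` G)"
    using card_coset_image[OF subgyrogroup_self fin] card sub by (simp add: Int_absorb2)
  then have "p * p ^ 2 = p * (m * card (coset ` G))"
    using m by (simp only: mult.assoc[symmetric] power3_eq_cube power2_eq_square)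
  then have "p ^ 2 = m * card (coset ` G)" using p(1) prime_gt_0_nat by (metis mult_left_cancel neq0_conv)
  then have Q: "card (coset ` G) dvd p ^ 2" by simp
  obtain g where g: "gyrogroup (coset ` G) set_sum g"
    using homomorphic_image_gyrogroup[OF fin, of coset set_sum] coset_hom by blast
  interpret Q: gyrogroup "coset ` G" set_sum g by (rule g)
  have Qn: "Q.neutral = coset neutral"
    by (rule Q.idempotent_unique)
      (simp_all only: Q.neutral_closed Q.neutral_left neutral_closed neutral_left imageI coset_hom[symmetric])
  have Qneg: "Q.neg (coset x) = coset (neg x)" if x: "x \<in> G" for x
  proof (rule Q.left_inverse_unique[of Q.neutral "coset x"])
    have cx: "coset x \<in> coset ` G" using x by (rule imageI)
    show "set_sum (Q.neg (coset x)) (coset x) = Q.neutral" "Q.neg (coset x) \<in> coset ` G"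
      using cx by (rule Q.neg_left, rule Q.neg_closed)
    show "set_sum (coset (neg x)) (coset x) = Q.neutral"
      using x by (simp only: coset_hom[symmetric] neg_closed neg_left Qn)
  qed (use x Q.neutral_spec in auto)
  have HG: "x \<in> G" "neg x \<in> H" if "x \<in> H" for x using that H by (auto simp: subgyrogroup_iff)
  have "subgyrogroup (coset ` H) (coset ` G) set_sum g"
    unfolding Q.subgyrogroup_iff Qn
  proof (intro conjI ballI)
    fix A B assume "A \<in> coset ` H" "B \<in> coset ` H"
    then obtain x y where "x \<in> H" "A = coset x" "y \<in> H" "B = coset y" by blast
    then have "x \<oplus> y \<in> H" "set_sum A B = coset (x \<oplus> y)"
      using H HG coset_hom by (auto simp: subgyrogroup_iff)
    then show "set_sum A B \<in> coset ` H" by blast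
  next
    fix A assume "A \<in> coset ` H"
    then obtain x where "x \<in> H" "A = coset x" by blast
    then show "Q.neg A \<in> coset ` H" using Qneg HG by auto
  qed (use H in \<open>auto simp: subgyrogroup_iff\<close>)
  then have "card (coset ` H) dvd p ^ 2"
    using Q.Lagrange_prime_square[OF p(1) _ Q] fin by simp
  then obtain s where s: "card (coset ` H) = p ^ s" using p by (auto simp: divides_primepow_nat)
  have "subgyrogroup (left_nucleus \<inter> H) G (\<oplus>) gyr" using N H by (auto simp: subgyrogroup_iff)
  then have "card (left_nucleus \<inter> H) dvd p ^ 3"
    using card_left_associating_dvd[OF _ left_associating_subset[OF left_nucleus_left_associating]
        subgyrogroup_self _ fin] sub card by auto
  then obtain t where t: "card (left_nucleus \<inter> H) = p ^ t" using p by (auto simp: divides_primepow_nat)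
  show ?thesis using card_coset_image[OF H fin] s t by (metis power_add)
qed

text \<open>
  A proper nontrivial subgyrogroup contains an element of even order, so its order is even; and
  it is at most 4.
\<close>
lemma Lagrange_order_eight:
  assumes card: "card G = 2 ^ 3" and H: "subgyrogroup H G (\<oplus>) gyr"
  shows "\<exists>i. card H = 2 ^ i"
proof (cases "H = G \<or> H = {neutral}")
  case False
  have fin: "finite G" using card by (metis card.infinite power_eq_0_iff zero_neq_numeral)
  have sub: "H \<subseteq> G" "neutral \<in> H" using H by (auto simp: subgyrogroup_iff)
  then obtain a where a: "a \<in> H" "a \<noteq> neutral" using False by blast
  have aG: "a \<in> G" using a sub by blast
  have "card (cyclic a) dvd 2 ^ 3"
    using card_cyclic_dvd[OF subgyrogroup_self aG fin] card by simp
  then obtain i where i: "card (cyclic a) = 2 ^ i"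
    using divides_primepow_nat[OF two_is_prime_nat] by blast
  have "card (cyclic a) \<noteq> 1"
    using multiple_card_cyclic(2)[OF aG fin, of "Suc 0"] a aG by auto
  then have "i \<noteq> 0" using i by (metis power_0)
  then have "2 dvd card (cyclic a)" using i by simp
  then have ev: "even (card H)" using card_cyclic_dvd[OF H a(1) fin] by (rule dvd_trans)
  have "card H \<le> 4" using card_proper_subgyrogroup[OF H fin] False card by simp
  moreover have "card H \<noteq> 0" using sub finite_subset[OF sub(1) fin] by auto
  ultimately have "card H = 2 \<or> card H = 4" using ev by presburger
  then have "card H = 2 ^ 1 \<or> card H = 2 ^ 2" by simp
  then show ?thesis by blast
next
  case True
  then show ?thesis using card by (metis card_1_singleton_iff power_0 One_nat_def)
qed

end

theorem theorem6p11:
  fixes p :: nat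
    and G :: "'a set"
    and oplus :: "'a \<Rightarrow> 'a \<Rightarrow> 'a"
    and gyr :: "'a \<Rightarrow> 'a \<Rightarrow> 'a \<Rightarrow> 'a"
  assumes "prime p"
    and "gyrogroup G oplus gyr"
    and "\<not> gyrocommutative G oplus gyr"
    and "card G = p ^ 3"
  shows "strong_Cauchy_property G oplus gyr"
proof -
  interpret gyrogroup G oplus gyr by (rule assms(2))
  have fin: "finite G" using assms(1,4) by (metis card.infinite power_eq_0_iff not_prime_0)
  have "weak_Cauchy_property H oplus gyr" if H: "subgyrogroup H G oplus gyr" for H
  proof -
    interpret H: gyrogroup H oplus gyr by (rule subgyrogroup_gyrogroup[OF H])
    have "\<exists>i. card H = p ^ i"
    proof (cases "odd p")
      case True
      then show ?thesis using Lagrange_prime_cube_odd assms(1,3,4) H by blast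
    next
      case False
      then have "p = 2" using assms(1) primes_dvd_imp_eq two_is_prime_nat by blast
      then show ?thesis using Lagrange_order_eight[OF _ H] assms(4) by simp
    qed
    then obtain i where "card H dvd p ^ i" by (metis dvd_refl)
    moreover have "finite H" using H fin by (auto simp: subgyrogroup_def intro: finite_subset)
    ultimately show ?thesis using H.prime_power_weak_Cauchy[OF assms(1)] by blast
  qed
  then show ?thesis using fin by (simp add: strong_Cauchy_property_def)
qed

end
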